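(* For every positive integer $\mathcal{Z}$ there exists a cannonball polygon of multiplicity $8$ whose final side has length $\mathcal{Z}$.
   Context: Fix a positive integer $s$. A cannonball polygon of multiplicity $s$ is a polygon with integer side lengths and a distinguished vertex $O$ satisfying: (i) for each side of the polygon there is a line perpendicular to that side passing through both $O$ and one of the two endpoints of that side; (ii) there are no degenerate vertices, i.e. no vertex has angle $0$ or $\pi$; (iii) as one traverses the polygon starting and finishing at $O$, the first side has length $1$, the lengths of consecutive sides are in non-decreasing order, the number of sides of length $1$ is at most $s$, and for $k\in\mathbb{N}$ the number of sides of length $k$ is non-increasing in $k$, except for the final side, which may have any integer length $\mathcal{Z}$. *)

theory Defs
  imports "HOL-Analysis.Analysis"
begin

text \<open>
  The Euclidean plane is \<^typ>\<open>complex\<close>. A polygon is given by the list of its vertices in the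
  order of traversal; side \<open>i\<close> joins vertex \<open>i\<close> to vertex \<open>i + 1\<close>, with indices read cyclically,
  so that the last side leads back to vertex \<open>0\<close>.
\<close>

definition vertex :: "complex list \<Rightarrow> nat \<Rightarrow> complex" where
  "vertex vs i = vs ! (i mod length vs)"

definition side_length :: "complex list \<Rightarrow> nat \<Rightarrow> real" where
  "side_length vs i = dist (vertex vs i) (vertex vs (Suc i))"

text \<open>
  The vertices of a polygon are pairwise distinct points; its sides are allowed to cross.
\<close>

definition is_polygon :: "complex list \<Rightarrow> bool" where
  "is_polygon vs \<longleftrightarrow> 3 \<le> length vs \<and> distinct vs"

text \<open>
  The unoriented angle \<open>ABC\<close> at \<open>B\<close>, with values between \<open>0\<close> and \<open>\<pi>\<close>.
\<close>

definition angle_at :: "complex \<Rightarrow> complex \<Rightarrow> complex \<Rightarrow> real" where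
  "angle_at a b c = arccos (((a - b) \<bullet> (c - b)) / (norm (a - b) * norm (c - b)))"

definition is_line :: "complex set \<Rightarrow> bool" where
  "is_line L \<longleftrightarrow> affine L \<and> aff_dim L = 1"

definition perpendicular_to_side :: "complex set \<Rightarrow> complex \<Rightarrow> complex \<Rightarrow> bool" where
  "perpendicular_to_side L a b \<longleftrightarrow> (\<forall>x\<in>L. \<forall>y\<in>L. orthogonal (y - x) (b - a))"

definition nonfinal_count :: "complex list \<Rightarrow> nat \<Rightarrow> nat" where
  "nonfinal_count vs k = card {i. i < length vs - 1 \<and> side_length vs i = real k}"

text \<open>
  The distinguished vertex \<open>O\<close> is vertex \<open>0\<close>. The final side is exempt from the ordering and from
  the counts. The counts are compared for \<open>k \<ge> 1\<close> only, since no side has length \<open>0\<close>.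
\<close>

definition cannonball_polygon :: "nat \<Rightarrow> complex list \<Rightarrow> bool" where
  "cannonball_polygon s vs \<longleftrightarrow>
     is_polygon vs \<and>
     (\<forall>i<length vs. side_length vs i \<in> \<int>) \<and>
     (\<forall>i<length vs. \<exists>L. is_line L \<and> perpendicular_to_side L (vertex vs i) (vertex vs (Suc i)) \<and>
        vertex vs 0 \<in> L \<and> (vertex vs i \<in> L \<or> vertex vs (Suc i) \<in> L)) \<and>
     (\<forall>i<length vs. angle_at (vertex vs i) (vertex vs (i + 1)) (vertex vs (i + 2)) \<notin> {0, pi}) \<and>
     side_length vs 0 = 1 \<and>
     (\<forall>i j. i \<le> j \<and> j < length vs - 1 \<longrightarrow> side_length vs i \<le> side_length vs j) \<and>
     nonfinal_count vs 1 \<le> s \<and>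
     (\<forall>k\<ge>1. nonfinal_count vs (Suc k) \<le> nonfinal_count vs k)"

definition final_side_length :: "complex list \<Rightarrow> real" where
  "final_side_length vs = side_length vs (length vs - 1)"

end

theory Submission
  imports Defs
begin

text \<open>
  Let \<open>r\<^sub>i\<close> be the distance of vertex \<open>i\<close> from \<open>O\<close> and \<open>l\<^sub>i\<close> the length of side \<open>i\<close>. Perpendicularity
  means \<open>r\<^sub>i\<^sub>+\<^sub>1\<^sup>2 = r\<^sub>i\<^sup>2 + l\<^sub>i\<^sup>2\<close> (outward step) or \<open>r\<^sub>i\<^sub>+\<^sub>1\<^sup>2 = r\<^sub>i\<^sup>2 - l\<^sub>i\<^sup>2\<close> (inward step), so \<open>Z\<^sup>2\<close> is a signed
  sum of squares. An outward step right after an inward one would make a degenerate vertex; thus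
  all outward steps come first. Conversely, every such sign pattern is realised: radii increase and
  then decrease, so an inward step can only collide with one earlier vertex, which one of its two
  possible directions avoids; the two possible positions of vertex 1 relative to the others serve
  to keep it off the line through \<open>O\<close> and the last vertex.

  It remains to write \<open>Z\<^sup>2\<close> as such a sum. Taking the multiset of lengths to be a union of eight
  segments \<open>{1..n}\<close> makes the multiplicities non-increasing, and the sum becomes a combination of
  square pyramidal numbers. Since \<open>3\<^sup>3 + 3\<^sup>3 + 3\<^sup>3 + (2 \<cdot> 3\<^sup>3 - 4\<^sup>3) + (2 \<cdot> 3\<^sup>3 - 5\<^sup>3) = 0\<close>, five segments
  of lengths about \<open>3t, 3t, 3t, 4t, 5t\<close>, with outward steps up to \<open>3t\<close>, give a quadratic polynomial
  in \<open>t\<close>; suitable shifts and three segments of constant length turn it into \<open>(t - 77)\<^sup>2\<close>.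
\<close>

section \<open>Plane geometry: angles, perpendiculars, tangents\<close>

definition cross :: "complex \<Rightarrow> complex \<Rightarrow> real" where
  "cross a b = Re a * Im b - Im a * Re b"

lemma inner_sq_plus_cross_sq: "(a \<bullet> b)\<^sup>2 + (cross a b)\<^sup>2 = (norm a)\<^sup>2 * (norm b)\<^sup>2"
  unfolding cmod_power2 cross_def inner_complex_def inner_real_def by algebra

lemma cross_eq_0_imp_scaleR:
  assumes "cross a b = 0" "b \<noteq> 0"
  obtains t where "a = t *\<^sub>R b"
proof -
  have "a = ((a \<bullet> b) / (norm b)\<^sup>2) *\<^sub>R b"
  proof -
    have nz: "(norm b)\<^sup>2 \<noteq> 0" using assms by simp
    have "(norm b)\<^sup>2 *\<^sub>R a = (a \<bullet> b) *\<^sub>R b"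
      using assms(1) unfolding cross_def cmod_power2 complex_eq_iff
      by (simp add: inner_complex_def power2_eq_square) algebra
    then have "(1 / (norm b)\<^sup>2) *\<^sub>R ((norm b)\<^sup>2 *\<^sub>R a) = (1 / (norm b)\<^sup>2) *\<^sub>R ((a \<bullet> b) *\<^sub>R b)"
      by simp
    then show ?thesis using nz by simp
  qed
  then show ?thesis by (rule that)
qed

text \<open>By Lagrange's identity a nonzero \<open>cross\<close> makes Cauchy-Schwarz strict, so
  the argument of \<open>arccos\<close> stays away from -1 and 1.\<close>

lemma angle_at_nondegenerate:
  assumes "cross (a - b) (c - b) \<noteq> 0"
  shows "angle_at a b c \<notin> {0, pi}"
proof -
  let ?u = "a - b" and ?w = "c - b"
  let ?x = "(?u \<bullet> ?w) / (norm ?u * norm ?w)"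
  have nz: "0 < norm ?u * norm ?w" using assms by (cases "?u = 0 \<or> ?w = 0") (auto simp: cross_def)
  have "0 < (cross ?u ?w)\<^sup>2" using assms by simp
  then have "(?u \<bullet> ?w)\<^sup>2 < (norm ?u * norm ?w)\<^sup>2"
    using inner_sq_plus_cross_sq[of ?u ?w] unfolding power_mult_distrib by linarith
  then have "\<bar>?u \<bullet> ?w\<bar> < norm ?u * norm ?w"
    using nz by (intro power2_less_imp_less[of "\<bar>?u \<bullet> ?w\<bar>"]) simp_all
  then have "\<bar>?x\<bar> < 1" using nz by (simp add: abs_divide)
  then have "- 1 < ?x" "?x < 1" by (simp_all only: abs_less_iff) linarith
  then have "arccos ?x \<noteq> 0" "arccos ?x \<noteq> pi"
    using arccos_lt_bounded[of ?x] by auto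
  then show ?thesis unfolding angle_at_def by simp
qed

lemma ex_perpendicular_line:
  assumes "x \<noteq> 0" "x \<bullet> (b - a) = 0" "a \<in> span {x} \<or> b \<in> span {x}"
  shows "\<exists>L. is_line L \<and> perpendicular_to_side L a b \<and> 0 \<in> L \<and> (a \<in> L \<or> b \<in> L)"
proof (intro exI conjI)
  show "is_line (span {x})"
    using assms(1) by (simp add: is_line_def aff_dim_subspace subspace_imp_affine dim_eq_card_independent)
  show "perpendicular_to_side (span {x}) a b"
    using assms(2) by (auto simp: perpendicular_to_side_def orthogonal_def span_singleton inner_diff_left)
qed (use assms(3) in \<open>auto simp: span_zero\<close>)

text \<open>
  The two points at squared distance \<open>s\<close> from the origin at which an inward step from \<open>z\<close> can end,
  i.e. the points of tangency of the lines through \<open>z\<close> to the circle of radius \<open>sqrt s\<close>.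
\<close>
lemma two_feet:
  fixes z :: complex
  assumes "0 < s" "s < (norm z)\<^sup>2"
  obtains a b where "cross a b \<noteq> 0"
    "(norm a)\<^sup>2 = s" "(z - a) \<bullet> a = 0" "(norm b)\<^sup>2 = s" "(z - b) \<bullet> b = 0"
proof -
  define N where "N = (norm z)\<^sup>2"
  \<comment> \<open>A foot is \<open>z\<close> turned by an angle u with cos u =
    \<open>sqrt (s / N)\<close> and scaled by cos u; thus \<open>c\<close> is cos^2 u and
    \<open>d\<close> is cos u sin u.\<close>
  define c where "c = s / N"
  define d where "d = sqrt (s * (N - s)) / N"
  have N: "0 < s" "s < N" using assms by (auto simp: N_def)
  have Nz: "Re z ^ 2 + Im z ^ 2 = N" by (simp add: N_def cmod_power2)
  have c: "c * N = s" using N by (simp add: c_def)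
  have "d\<^sup>2 = s * (N - s) / N\<^sup>2" using N by (simp add: d_def power_divide)
  also have "\<dots> = c - c\<^sup>2"
    using N by (simp add: c_def field_simps power2_eq_square)
  finally have cd: "c\<^sup>2 + d\<^sup>2 = c" by simp
  have "c \<noteq> 0" "d \<noteq> 0" using N by (auto simp: c_def d_def)
  have norm: "(norm (z * Complex c e))\<^sup>2 = s" if "e\<^sup>2 = d\<^sup>2" for e
    using that cd c by (simp add: norm_mult power_mult_distrib cmod_power2 Nz mult.commute)
  have perp: "(z - z * Complex c e) \<bullet> (z * Complex c e) = 0" if "e\<^sup>2 = d\<^sup>2" for e
  proof -
    have "(z - z * Complex c e) \<bullet> (z * Complex c e) = (Re z ^ 2 + Im z ^ 2) * (c - (c\<^sup>2 + e\<^sup>2))"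
      by (simp add: inner_complex_def power2_eq_square algebra_simps)
    then show ?thesis using that cd by simp
  qed
  have "cross (z * Complex c d) (z * Complex c (- d)) = - 2 * c * d * (Re z ^ 2 + Im z ^ 2)"
    by (simp add: cross_def power2_eq_square algebra_simps)
  then have "cross (z * Complex c d) (z * Complex c (- d)) \<noteq> 0"
    using Nz N \<open>c \<noteq> 0\<close> \<open>d \<noteq> 0\<close> by simp
  then show ?thesis using norm[of d] norm[of "-d"] perp[of d] perp[of "-d"]
    by (intro that[of "z * Complex c d" "z * Complex c (- d)"]) simp_all
qed

text \<open>Multiplying \<open>z\<close> by \<open>Complex 1 e\<close> adds a vector of length
  \<open>sqrt q\<close> perpendicular to \<open>z\<close>.\<close>

lemma ex_outward_step:
  fixes z :: complex
  assumes "z \<noteq> 0" "0 < q"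
  obtains a where "(norm a)\<^sup>2 = (norm z)\<^sup>2 + q" "(a - z) \<bullet> z = 0"
proof
  define e where "e = sqrt q / norm z"
  have e: "e\<^sup>2 * (norm z)\<^sup>2 = q" using assms by (simp add: e_def power_divide)
  have "(norm (z * Complex 1 e))\<^sup>2 = (norm z)\<^sup>2 * (1 + e\<^sup>2)"
    by (simp add: norm_mult power_mult_distrib cmod_power2)
  then show "(norm (z * Complex 1 e))\<^sup>2 = (norm z)\<^sup>2 + q" using e by (simp add: algebra_simps)
  show "(z * Complex 1 e - z) \<bullet> z = 0"
    by (simp add: inner_complex_def algebra_simps)
qed

section \<open>Vertices at prescribed distances from \<open>O\<close>\<close>

text \<open>\<open>R i\<close> is the squared distance of vertex \<open>i\<close> from \<open>O\<close>; the first \<open>p\<close> steps go outward.\<close>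
locale radii =
  fixes R :: "nat \<Rightarrow> real" and p n :: nat
  assumes p_ge_2: "2 \<le> p" and p_le_n: "p \<le> n"
    and R_0: "R 0 = 0"
    and R_increasing: "i < p \<Longrightarrow> R i < R (Suc i)"
    and R_decreasing: "p \<le> i \<Longrightarrow> i < n \<Longrightarrow> R (Suc i) < R i"
    and R_1_le: "R 1 \<le> R n"
begin

lemma R_mono: "i < j \<Longrightarrow> j \<le> p \<Longrightarrow> R i < R j"
proof (induction j)
  case (Suc j)
  then show ?case using R_increasing[of j] by (cases "i = j") auto
qed simp

lemma R_antimono: "p \<le> i \<Longrightarrow> i < j \<Longrightarrow> j \<le> n \<Longrightarrow> R j < R i"
proof (induction j)
  case (Suc j)
  then show ?case using R_decreasing[of j] by (cases "i = j") auto
qed simp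

lemma R_pos:
  assumes "0 < i" "i \<le> n"
  shows "0 < R i"
proof (cases "i \<le> p")
  case True
  then show ?thesis using R_mono[of 0 i] assms R_0 by simp
next
  case False
  have "0 < R n" using R_mono[of 0 1] R_0 R_1_le p_ge_2 by simp
  moreover have "R n \<le> R i" using R_antimono[of i n] False assms by (cases "i = n") auto
  ultimately show ?thesis by simp
qed

text \<open>The right angle of side \<open>i\<close> sits at its endpoint nearer to
  \<open>O\<close>: \<open>i\<close> for an outward step, \<open>Suc i\<close> for an inward one.
  The lower index is free because vertices 0 and 1 are placed last.\<close>

definition trail :: "nat \<Rightarrow> nat \<Rightarrow> (nat \<Rightarrow> complex) \<Rightarrow> bool" where
  "trail j k v \<longleftrightarrow> (\<forall>i\<in>{j..k}. (norm (v i))\<^sup>2 = R i) \<and> inj_on v {j..k} \<and>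
     (\<forall>i\<in>{j..<k}. (v (Suc i) - v i) \<bullet> v (if i < p then i else Suc i) = 0)"

lemma trail_extend:
  assumes v: "trail j k v" "j \<le> k" and a: "(norm a)\<^sup>2 = R (Suc k)" "a \<notin> v ` {j..k}"
    and perp: "(a - v k) \<bullet> (if k < p then v k else a) = 0"
  shows "trail j (Suc k) (v(Suc k := a))"
proof -
  let ?v = "v(Suc k := a)"
  have "inj_on ?v {j..Suc k}"
    using v a(2) by (auto simp: trail_def atLeastAtMostSuc_conv inj_on_def)
  moreover have "\<forall>i\<in>{j..Suc k}. (norm (?v i))\<^sup>2 = R i"
    using v a(1) by (auto simp: trail_def)
  moreover have "\<forall>i\<in>{j..<Suc k}. (?v (Suc i) - ?v i) \<bullet> ?v (if i < p then i else Suc i) = 0"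
    using v perp by (fastforce simp: trail_def less_Suc_eq split: if_splits)
  ultimately show ?thesis unfolding trail_def by blast
qed

lemma ex_trail_from_2: "2 \<le> k \<Longrightarrow> k \<le> n \<Longrightarrow> \<exists>v. trail 2 k v"
proof (induction k rule: dec_induct)
  case base
  have "trail 2 2 (\<lambda>_. complex_of_real (sqrt (R 2)))"
    using R_pos[of 2] p_ge_2 p_le_n by (simp add: trail_def)
  then show ?case by blast
next
  case (step k)
  then obtain v where v: "trail 2 k v" by auto
  have nv: "(norm (v i))\<^sup>2 = R i" if "2 \<le> i" "i \<le> k" for i using v that by (simp add: trail_def)
  have "v k \<noteq> 0" using nv[of k] R_pos[of k] step by auto
  have "\<exists>a. (norm a)\<^sup>2 = R (Suc k) \<and> a \<notin> v ` {2..k} \<and> (a - v k) \<bullet> (if k < p then v k else a) = 0"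
  proof (cases "k < p")
    case True
    obtain a where a: "(norm a)\<^sup>2 = (norm (v k))\<^sup>2 + (R (Suc k) - R k)" "(a - v k) \<bullet> v k = 0"
      using ex_outward_step[OF \<open>v k \<noteq> 0\<close>, of "R (Suc k) - R k"] R_increasing[OF True] by auto
    then have na: "(norm a)\<^sup>2 = R (Suc k)" using nv[of k] step by simp
    have "a \<noteq> v i" if "2 \<le> i" "i \<le> k" for i
      using nv[OF that] na R_mono[of i "Suc k"] True that by auto
    then have "a \<notin> v ` {2..k}" by force
    then show ?thesis using a na True by auto
  next
    case False
    obtain a b where ab: "cross a b \<noteq> 0" "(norm a)\<^sup>2 = R (Suc k)" "(v k - a) \<bullet> a = 0"
      "(norm b)\<^sup>2 = R (Suc k)" "(v k - b) \<bullet> b = 0"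
      using two_feet[of "R (Suc k)" "v k"] nv[of k] step R_pos[of "Suc k"] R_decreasing[of k] False
      by auto
    have "a \<noteq> b" using ab(1) by (auto simp: cross_def)
    \<comment> \<open>From the peak \<open>p\<close> on, earlier radii exceed the new one, so
      equality occurs only on the strictly increasing part, at a single index.\<close>
    have same: "i = i'" if "i \<in> {2..k}" "i' \<in> {2..k}" "R i = R (Suc k)" "R i' = R (Suc k)" for i i'
    proof -
      have "i < p" "i' < p"
        using that R_antimono[of i "Suc k"] R_antimono[of i' "Suc k"] step by force+
      then show ?thesis using that R_mono[of i i'] R_mono[of i' i] by (cases i i' rule: linorder_cases) auto
    qed
    have "a \<notin> v ` {2..k} \<or> b \<notin> v ` {2..k}"
    proof (rule ccontr)
      assume "\<not> ?thesis"
      then obtain i i' where i: "i \<in> {2..k}" "i' \<in> {2..k}" "a = v i" "b = v i'" by auto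
      then have "i = i'" using same[of i i'] nv ab by auto
      then show False using i \<open>a \<noteq> b\<close> by simp
    qed
    moreover have "(a - v k) \<bullet> a = 0" "(b - v k) \<bullet> b = 0"
      using ab by (auto simp: inner_diff_left)
    ultimately show ?thesis using ab False by auto
  qed
  then show ?case using trail_extend[OF v] step by blast
qed

text \<open>The \<open>cross\<close> condition is what the angle at \<open>O\<close>
  requires.\<close>

lemma ex_trail: "\<exists>v. trail 0 n v \<and> v 0 = 0 \<and> cross (v n) (v 1) \<noteq> 0"
proof -
  obtain v where v: "trail 2 n v" using ex_trail_from_2[of n] p_ge_2 p_le_n by auto
  have nv: "(norm (v i))\<^sup>2 = R i" if "2 \<le> i" "i \<le> n" for i using v that by (simp add: trail_def)
  have n2: "2 \<le> n" using p_ge_2 p_le_n by simp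
  \<comment> \<open>Reversed, the outward step from vertex 1 to vertex 2 is an inward one, so vertex
    1 is a foot for \<open>v 2\<close>.\<close>
  obtain a b where ab: "cross a b \<noteq> 0" "(norm a)\<^sup>2 = R 1" "(v 2 - a) \<bullet> a = 0"
      "(norm b)\<^sup>2 = R 1" "(v 2 - b) \<bullet> b = 0"
    using two_feet[of "R 1" "v 2"] nv[of 2] n2 R_pos[of 1] R_mono[of 1 2] p_ge_2 by auto
  have vn: "v n \<noteq> 0" using nv[of n] R_pos[of n] n2 by auto
  have "cross (v n) a \<noteq> 0 \<or> cross (v n) b \<noteq> 0"
  proof (rule ccontr)
    assume "\<not> ?thesis"
    then have "cross a (v n) = 0" "cross b (v n) = 0" by (auto simp: cross_def algebra_simps)
    then obtain s t where "a = s *\<^sub>R v n" "b = t *\<^sub>R v n" using vn cross_eq_0_imp_scaleR by metis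
    then show False using ab(1) by (simp add: cross_def)
  qed
  then obtain c where c: "cross (v n) c \<noteq> 0" "(norm c)\<^sup>2 = R 1" "(v 2 - c) \<bullet> c = 0"
    using ab by blast
  define w where "w = v(0 := 0, 1 := c)"
  have w: "w 0 = 0" "w (Suc 0) = c" "\<And>i. 2 \<le> i \<Longrightarrow> w i = v i" by (auto simp: w_def)
  have nw: "(norm (w i))\<^sup>2 = R i" if "i \<le> n" for i
    using nv that c(2) R_0 w by (cases "2 \<le> i") (auto simp: not_le less_2_cases_iff)
  \<comment> \<open>A later vertex as close to \<open>O\<close> as \<open>c\<close> lies beyond the
    peak; since \<open>R 1 \<le> R n\<close>, it is the last one, which is not collinear with
    \<open>O\<close> and \<open>c\<close>.\<close>
  have c_notin: "c \<noteq> v i" if i: "2 \<le> i" "i \<le> n" for i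
  proof
    assume eq: "c = v i"
    then have Ri: "R i = R 1" using nv[OF i] c(2) by simp
    have "p < i" using R_mono[of 1 i] Ri i by force
    then have "i = n" using R_antimono[of i n] Ri R_1_le i by force
    then show False using eq c(1) by (simp add: cross_def)
  qed
  have inj: "w i \<noteq> w j" if ij: "i < j" "j \<le> n" for i j
  proof -
    consider "i = 0" | "i = 1" | "2 \<le> i" by linarith
    then show ?thesis
    proof cases
      case 1
      then show ?thesis using nw[of j] R_pos[of j] ij w by auto
    next
      case 2
      then show ?thesis using c_notin[of j] ij w by auto
    next
      case 3
      have "inj_on v {2..n}" using v by (simp add: trail_def)
      then show ?thesis using 3 ij w by (auto dest: inj_onD[of v _ i j])
    qed
  qed
  have "inj_on w {0..n}"
    by (rule linorder_inj_onI) (use inj in auto)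
  moreover have "(w (Suc i) - w i) \<bullet> w (if i < p then i else Suc i) = 0" if i: "i < n" for i
  proof -
    consider "i = 0" | "i = 1" | "2 \<le> i" by linarith
    then show ?thesis
    proof cases
      case 1
      then show ?thesis using w p_ge_2 by simp
    next
      case 2
      then show ?thesis using w p_ge_2 c(3) by (simp add: numeral_2_eq_2)
    next
      case 3
      then have "(v (Suc i) - v i) \<bullet> v (if i < p then i else Suc i) = 0"
        using v i unfolding trail_def by auto
      then show ?thesis using 3 w by simp
    qed
  qed
  ultimately have "trail 0 n w" using nw by (auto simp: trail_def)
  moreover have "cross (w n) (w 1) \<noteq> 0" using c(1) w n2 by simp
  ultimately show ?thesis using w(1) by blast
qed

end


section \<open>From a sorted list of lengths to a polygon\<close>

text \<open>A single threshold on the lengths puts the outward steps first once the lengths are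
  sorted.\<close>

definition signed_square :: "nat \<Rightarrow> nat \<Rightarrow> real" where
  "signed_square m k = (if k \<le> m then (real k)\<^sup>2 else - (real k)\<^sup>2)"

lemma sorted_less_length_filter_iff:
  assumes "sorted xs" "i < length xs"
  shows "i < length (filter (\<lambda>x. x \<le> m) xs) \<longleftrightarrow> xs ! i \<le> (m :: 'a :: linorder)"
  using assms
proof (induction xs arbitrary: i)
  case (Cons x xs)
  show ?case
  proof (cases "x \<le> m")
    case True
    then show ?thesis using Cons by (cases i) auto
  next
    case False
    then have "filter (\<lambda>x. x \<le> m) (x # xs) = []"
      using Cons.prems(1) by (auto simp: filter_empty_conv)
    moreover have "x \<le> (x # xs) ! i" using Cons.prems by (cases i) auto
    ultimately show ?thesis using False by auto
  qed
qed simp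

text \<open>Partial sums of the signed squares serve as squared radii; the last vertex is then at
  distance \<open>Z\<close> from \<open>O\<close>, which is the length of the closing side.\<close>

lemma cannonball_polygon_of_sorted_list:
  fixes ls :: "nat list"
  assumes sorted: "sorted ls" and pos: "0 \<notin> set ls" and first: "ls ! 0 = 1"
    and plus: "2 \<le> length (filter (\<lambda>x. x \<le> m) ls)"
    and sum: "sum_list (map (signed_square m) ls) = (real Z)\<^sup>2" and Z: "0 < Z"
    and count_1: "card {i. i < length ls \<and> ls ! i = 1} \<le> s"
    and count_mono: "\<And>k. 1 \<le> k \<Longrightarrow>
      card {i. i < length ls \<and> ls ! i = Suc k} \<le> card {i. i < length ls \<and> ls ! i = k}"
  shows "\<exists>vs. cannonball_polygon s vs \<and> final_side_length vs = real Z"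
proof -
  define n where "n = length ls"
  define p where "p = length (filter (\<lambda>x. x \<le> m) ls)"
  define R where "R i = (\<Sum>j<i. signed_square m (ls ! j))" for i
  have p_iff: "i < p \<longleftrightarrow> ls ! i \<le> m" if "i < n" for i
    using sorted_less_length_filter_iff[OF sorted] that by (simp add: n_def p_def)
  have ls_pos: "0 < ls ! i" if "i < n" for i
    using that pos by (metis n_def nth_mem gr0I)
  have p2: "2 \<le> p" and pn: "p \<le> n" using plus by (auto simp: p_def n_def)
  have R_Suc: "R (Suc i) = R i + (if i < p then (real (ls ! i))\<^sup>2 else - (real (ls ! i))\<^sup>2)"
    if "i < n" for i
    using p_iff[OF that] by (simp add: R_def signed_square_def)
  have R_n: "R n = (real Z)\<^sup>2"
    using sum by (simp add: R_def n_def sum_list_sum_nth atLeast0LessThan)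
  have "1 \<le> m" using p_iff[of 0] p2 pn first by simp
  then have R_1: "R 1 = 1" using first by (simp add: R_def signed_square_def)
  interpret radii R p n
  proof
    show "R i < R (Suc i)" if "i < p" for i using R_Suc[of i] ls_pos[of i] that pn by simp
    show "R (Suc i) < R i" if "p \<le> i" "i < n" for i using R_Suc[of i] ls_pos[of i] that by simp
    show "R 1 \<le> R n" using R_1 R_n Z by (simp add: one_le_power)
  qed (use p2 pn in \<open>auto simp: R_def\<close>)
  obtain v where v: "trail 0 n v" "v 0 = 0" "cross (v n) (v 1) \<noteq> 0"
    using ex_trail by blast
  have nv: "(norm (v i))\<^sup>2 = R i" if "i \<le> n" for i using v(1) that by (simp add: trail_def)
  have inj: "inj_on v {0..n}" using v(1) by (simp add: trail_def)
  have perp: "(v (Suc i) - v i) \<bullet> v (if i < p then i else Suc i) = 0" if "i < n" for i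
    using v(1) that unfolding trail_def by auto
  have out: "(v (Suc i) - v i) \<bullet> v i = 0" if "i < p" for i
    using perp[of i] that pn by simp
  have inw: "(v (Suc i) - v i) \<bullet> v (Suc i) = 0" if "p \<le> i" "i < n" for i
    using perp[of i] that by simp
  have v_nz: "v i \<noteq> 0" if "0 < i" "i \<le> n" for i using nv[of i] R_pos[of i] that by auto
  define vs where "vs = map v [0..<Suc n]"
  have len: "length vs = Suc n" by (simp add: vs_def)
  have vert: "vertex vs i = v i" if "i \<le> n" for i
    using that by (simp add: vertex_def vs_def del: upt_Suc)
  have vert_n: "vertex vs (Suc n) = 0" "vertex vs (Suc (Suc n)) = v 1"
    using v(2) p2 pn by (simp_all add: vertex_def vs_def mod_Suc del: upt_Suc)
  \<comment> \<open>The inner product vanishes in the first form for a right angle at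
    \<open>a\<close>, in the second for one at \<open>b\<close>.\<close>
  have expand: "(norm b)\<^sup>2 = (norm a)\<^sup>2 + 2 * ((b - a) \<bullet> a) + (norm (b - a))\<^sup>2"
    "(norm b)\<^sup>2 = (norm a)\<^sup>2 + 2 * ((b - a) \<bullet> b) - (norm (b - a))\<^sup>2" for a b :: complex
    by (simp_all add: power2_norm_eq_inner inner_diff_left inner_diff_right inner_commute)
  have step: "(norm (v (Suc i) - v i))\<^sup>2 = (real (ls ! i))\<^sup>2" if "i < n" for i
    using expand[of "v (Suc i)" "v i"] out[of i] inw[of i] R_Suc[OF that] nv[of i] nv[of "Suc i"] that
    by (cases "i < p") auto
  have side: "side_length vs i = real (ls ! i)" if "i < n" for i
    using step[OF that] that by (simp add: side_length_def vert dist_norm norm_minus_commute)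
  have "norm (v n) = real Z" using nv[of n] R_n by simp
  then have side_n: "side_length vs n = real Z" by (simp add: side_length_def vert vert_n dist_norm)
  have "is_polygon vs"
    using inj p2 pn
    by (simp add: is_polygon_def vs_def distinct_map atLeastLessThanSuc_atLeastAtMost del: upt_Suc)
  moreover have "side_length vs i \<in> \<int>" if "i < length vs" for i
    using that side[of i] side_n by (cases "i = n") (auto simp: len)
  moreover have "\<exists>L. is_line L \<and> perpendicular_to_side L (vertex vs i) (vertex vs (Suc i)) \<and>
        vertex vs 0 \<in> L \<and> (vertex vs i \<in> L \<or> vertex vs (Suc i) \<in> L)" if i: "i < length vs" for i
  proof -
    have v0: "vertex vs 0 = 0" using v(2) by (simp add: vert)
    consider "i = 0" | "0 < i" "i < p" | "p \<le> i" "i < n" | "i = n" using i len by linarith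
    then have "\<exists>x. x \<noteq> 0 \<and> x \<bullet> (vertex vs (Suc i) - vertex vs i) = 0 \<and>
      (vertex vs i \<in> span {x} \<or> vertex vs (Suc i) \<in> span {x})"
    proof cases
      case 1
      have "v 1 \<noteq> 0" using v_nz[of 1] p2 pn by simp
      \<comment> \<open>This side starts at \<open>O\<close>, so its perpendicular there is spanned
        by a quarter turn of it.\<close>
      then show ?thesis using 1 v(2) p2 pn
        by (intro exI[of _ "\<i> * v 1"]) (simp add: vert inner_complex_def span_zero)
    next
      case 2
      then show ?thesis using out[of i] v_nz[of i] pn
        by (intro exI[of _ "v i"]) (simp add: vert inner_commute span_base)
    next
      case 3
      then show ?thesis using inw[of i] v_nz[of "Suc i"]
        by (intro exI[of _ "v (Suc i)"]) (simp add: vert inner_commute span_base)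
    next
      case 4
      have "v n \<noteq> 0" using v_nz[of n] p2 pn by simp
      then show ?thesis using 4
        by (intro exI[of _ "\<i> * v n"]) (simp add: vert vert_n inner_complex_def span_zero)
    qed
    then show ?thesis using ex_perpendicular_line unfolding v0 by blast
  qed
  moreover have "angle_at (vertex vs i) (vertex vs (i + 1)) (vertex vs (i + 2)) \<notin> {0, pi}"
    if i: "i < length vs" for i
  proof (rule angle_at_nondegenerate)
    consider "i = n" | "Suc i = n" | "Suc i < n" using i len by linarith
    then show "cross (vertex vs i - vertex vs (i + 1)) (vertex vs (i + 2) - vertex vs (i + 1)) \<noteq> 0"
    proof cases
      case 1
      then show ?thesis using v(3) by (simp add: vert vert_n)
    next
      case 2
      \<comment> \<open>If \<open>v i\<close> were on the line through \<open>O\<close> and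
        \<open>v n\<close>, this right angle would force \<open>v i = v n\<close> or
        \<open>v i = 0\<close>.\<close>
      have inn: "v n \<bullet> (v n - v i) = 0 \<or> v i \<bullet> (v n - v i) = 0"
        using out[of i] inw[of i] 2 pn by (cases "i < p") (auto simp: inner_commute)
      show ?thesis
      proof
        assume "cross (vertex vs i - vertex vs (i + 1)) (vertex vs (i + 2) - vertex vs (i + 1)) = 0"
        then have "cross (v i - v n) (- v n) = 0" using 2 by (simp add: vert vert_n)
        moreover have vn: "v n \<noteq> 0" using v_nz[of n] 2 by simp
        ultimately obtain t where t: "v i - v n = t *\<^sub>R (- v n)"
          using cross_eq_0_imp_scaleR[of "v i - v n" "- v n"] by auto
        then have vi: "v i = (1 - t) *\<^sub>R v n" by (simp add: algebra_simps)
        then have "v n - v i = t *\<^sub>R v n" by (simp add: algebra_simps)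
        then have "t = 0 \<or> t = 1" using inn vn unfolding vi by auto
        then have "v i = v n \<or> v i = 0" using vi by auto
        moreover have "v i \<noteq> v n" using inj 2 by (auto dest: inj_onD)
        moreover have "v i \<noteq> 0" using v_nz[of i] 2 p2 pn by auto
        ultimately show False by simp
      qed
    next
      case 3
      let ?a = "v i" and ?b = "v (Suc i)" and ?c = "v (Suc (Suc i))"
      have u: "(?a - ?b) \<bullet> ?b = - (norm (?a - ?b))\<^sup>2" if "i < p"
        using out[OF that] by (simp add: power2_norm_eq_inner algebra_simps inner_commute)
      have u': "(?a - ?b) \<bullet> ?b = 0" if "p \<le> i"
        using inw[of i] that 3 by (simp add: algebra_simps)
      have w: "(?c - ?b) \<bullet> ?b = 0" if "Suc i < p"
        using out[OF that] .
      have w': "(?c - ?b) \<bullet> ?b = - (norm (?c - ?b))\<^sup>2" if "p \<le> Suc i"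
        using inw[of "Suc i"] that 3 by (simp add: power2_norm_eq_inner algebra_simps inner_commute)
      have ne: "?a \<noteq> ?b" "?b \<noteq> ?c" "?a \<noteq> ?c" using inj 3 by (auto dest: inj_onD)
      have "cross (?a - ?b) (?c - ?b) \<noteq> 0"
      proof
        assume "cross (?a - ?b) (?c - ?b) = 0"
        then obtain t where t: "?a - ?b = t *\<^sub>R (?c - ?b)"
          using cross_eq_0_imp_scaleR[of "?a - ?b" "?c - ?b"] ne by auto
        then have t0: "t \<noteq> 0" and t1: "t \<noteq> 1" using ne by auto
        have *: "(?a - ?b) \<bullet> ?b = t * ((?c - ?b) \<bullet> ?b)" unfolding t by simp
        have **: "(norm (?a - ?b))\<^sup>2 = t\<^sup>2 * (norm (?c - ?b))\<^sup>2" unfolding t by (simp add: power_mult_distrib)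
        \<comment> \<open>For two outward or two inward steps exactly one side is perpendicular to
          \<open>?b\<close>. At the peak \<open>t = 1\<close> would follow, hence
          \<open>?a = ?c\<close>. Inward then outward does not occur.\<close>
        consider "Suc i < p" | "i < p" "p \<le> Suc i" | "p \<le> i" by linarith
        then show False
        proof cases
          case 1
          then show False using * u w ne by simp
        next
          case 2
          then have "t\<^sup>2 * (norm (?c - ?b))\<^sup>2 = t * (norm (?c - ?b))\<^sup>2" using * ** u w' by simp
          then show False using ne t0 t1 by (simp add: power2_eq_square)
        next
          case 3
          then show False using * u' w' ne t0 by simp
        qed
      qed
      then show ?thesis using 3 by (simp add: vert)
    qed
  qed
  moreover have "side_length vs 0 = 1" using side[of 0] first p2 pn by simp
  moreover have "side_length vs i \<le> side_length vs j" if "i \<le> j" "j < length vs - 1" for i j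
    using that side[of i] side[of j] sorted by (simp add: len n_def sorted_nth_mono)
  moreover have count: "nonfinal_count vs k = card {i. i < length ls \<and> ls ! i = k}" for k
    unfolding nonfinal_count_def len by (rule arg_cong[of _ _ card]) (auto simp: side n_def)
  ultimately have "cannonball_polygon s vs"
    unfolding cannonball_polygon_def using count_1 count_mono by simp
  moreover have "final_side_length vs = real Z"
    using side_n by (simp add: final_side_length_def len)
  ultimately show ?thesis by blast
qed

section \<open>Lengths taken from initial segments\<close>

text \<open>A length \<open>k \<ge> 1\<close> occurs once for each entry of \<open>ns\<close> that
  is at least \<open>k\<close>, so multiplicities do not increase with \<open>k\<close> and are at
  most \<open>length ns\<close>.\<close>

lemma cannonball_polygon_of_initial_segments:
  fixes ns :: "nat list"
  assumes len: "length ns \<le> s" and m: "1 \<le> m" and two: "2 \<le> length (filter ((\<le>) 1) ns)"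
    and sum: "(\<Sum>n\<leftarrow>ns. \<Sum>k=1..n. signed_square m k) = (real Z)\<^sup>2" and Z: "0 < Z"
  shows "\<exists>vs. cannonball_polygon s vs \<and> final_side_length vs = real Z"
proof -
  define xs where "xs = concat (map (\<lambda>n. [1..<Suc n]) ns)"
  have filter_upt: "length (filter (\<lambda>x. x = k) [1..<Suc n]) = (if k \<le> n then 1 else 0)"
    if "1 \<le> k" for k n
    using that by (induction n) auto
  have count_xs: "length (filter (\<lambda>x. x = k) xs) = length (filter ((\<le>) k) ns)" if "1 \<le> k" for k
    unfolding xs_def
  proof (induction ns)
    case (Cons n ns)
    then show ?case using filter_upt[OF that, of n] by (simp del: upt_Suc)
  qed simp
  have count: "card {i. i < length (sort xs) \<and> sort xs ! i = k} = length (filter ((\<le>) k) ns)"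
    if "1 \<le> k" for k
    using count_xs[OF that] length_filter_conv_card[of "\<lambda>x. x = k" "sort xs"] by (simp add: filter_sort)
  have filter_mono: "length (filter P ys) \<le> length (filter Q ys)"
    if "\<And>y. P y \<Longrightarrow> Q y" for P Q and ys :: "nat list"
    using that by (induction ys) (auto simp: le_Suc_eq)
  show ?thesis
  proof (rule cannonball_polygon_of_sorted_list)
    show "0 \<notin> set (sort xs)" by (auto simp: xs_def)
    show "2 \<le> length (filter (\<lambda>x. x \<le> m) (sort xs))"
      using two count_xs[of 1] filter_mono[of "\<lambda>x. x = 1" "\<lambda>x. x \<le> m" xs] m
      by (simp add: filter_sort)
    have "filter (\<lambda>x. x = 1) xs \<noteq> []" using two count_xs[of 1] by force
    then have "1 \<in> set xs" by (auto simp: filter_empty_conv)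
    then obtain i where "i < length (sort xs)" "sort xs ! i = 1"
      by (metis in_set_conv_nth set_sort)
    then have "sort xs ! 0 \<le> 1" "0 < length (sort xs)"
      using sorted_nth_mono[of "sort xs" 0 i] by auto
    moreover have "sort xs ! 0 \<noteq> 0"
      using nth_mem[OF \<open>0 < length (sort xs)\<close>] by (auto simp: xs_def)
    ultimately show "sort xs ! 0 = 1" by simp
    have "sum_list (map (signed_square m) (sort xs)) = sum_list (map (signed_square m) xs)"
      by (simp flip: sum_mset_sum_list)
    also have "\<dots> = (\<Sum>n\<leftarrow>ns. \<Sum>k=1..n. signed_square m k)"
      unfolding xs_def
      by (induction ns)
        (simp_all add: sum_list_distinct_conv_sum_set atLeastLessThanSuc_atLeastAtMost del: upt_Suc)
    finally show "sum_list (map (signed_square m) (sort xs)) = (real Z)\<^sup>2" using sum by simp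
    show "card {i. i < length (sort xs) \<and> sort xs ! i = 1} \<le> s"
      unfolding count[OF order_refl] using len length_filter_le order_trans by blast
    show "card {i. i < length (sort xs) \<and> sort xs ! i = Suc k}
        \<le> card {i. i < length (sort xs) \<and> sort xs ! i = k}" if "1 \<le> k" for k
      using that by (simp only: count) (auto simp: count intro!: filter_mono)
  qed (use Z in simp_all)
qed

section \<open>Square pyramidal numbers\<close>

text \<open>A polynomial over the reals, so that the final identity is purely algebraic.\<close>

definition pyramidal :: "real \<Rightarrow> real" where
  "pyramidal x = x * (x + 1) * (2 * x + 1) / 6"

lemma sum_squares_eq_pyramidal: "(\<Sum>k=Suc 0..n. (real k)\<^sup>2) = pyramidal (real n)"
  by (induction n) (simp_all add: pyramidal_def field_simps power2_eq_square)

lemma sum_signed_square: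
  "(\<Sum>k=1..n. signed_square m k) =
    (if n \<le> m then pyramidal (real n) else 2 * pyramidal (real m) - pyramidal (real n))"
proof (cases "n \<le> m")
  case True
  then have "(\<Sum>k=1..n. signed_square m k) = (\<Sum>k=1..n. (real k)\<^sup>2)"
    by (intro sum.cong) (auto simp: signed_square_def)
  then show ?thesis using True by (simp add: sum_squares_eq_pyramidal)
next
  case False
  then have split: "{1..n} = {1..m} \<union> {Suc m..n}" by auto
  have "(\<Sum>k=1..n. signed_square m k) = (\<Sum>k=1..m. (real k)\<^sup>2) - (\<Sum>k=Suc m..n. (real k)\<^sup>2)"
    unfolding split by (subst sum.union_disjoint) (auto simp: signed_square_def sum_negf)
  moreover have "(\<Sum>k=1..n. (real k)\<^sup>2) = (\<Sum>k=1..m. (real k)\<^sup>2) + (\<Sum>k=Suc m..n. (real k)\<^sup>2)"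
    unfolding split by (subst sum.union_disjoint) auto
  ultimately show ?thesis using False by (simp add: sum_squares_eq_pyramidal)
qed

text \<open>With \<open>t = z + 77\<close> the five growing segments give t^2 - 154 t - 60; the
  fixed ones add 650 + 1015 + 4324 = 5989, which completes the square.\<close>

lemma pyramidal_identity:
  "pyramidal (3 * z + 228) + (2 * pyramidal (3 * z + 231) - pyramidal (3 * z + 234))
   + (2 * pyramidal (3 * z + 231) - pyramidal (3 * z + 236))
   + (2 * pyramidal (3 * z + 231) - pyramidal (4 * z + 304))
   + (2 * pyramidal (3 * z + 231) - pyramidal (5 * z + 384))
   + pyramidal 12 + pyramidal 14 + pyramidal 23 = z\<^sup>2"
proof -
  have "pyramidal x = (2 * x ^ 3 + 3 * x\<^sup>2 + x) / 6" for x
    by (simp add: pyramidal_def power2_eq_square power3_eq_cube algebra_simps)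
  then show ?thesis
    by (simp add: power2_eq_square power3_eq_cube algebra_simps add_divide_distrib diff_divide_distrib)
qed

theorem theorem1p1:
  fixes Z :: nat
  assumes "0 < Z"
  shows "\<exists>vs. cannonball_polygon 8 vs \<and> final_side_length vs = real Z"
proof (rule cannonball_polygon_of_initial_segments)
  \<comment> \<open>the shifts found for \<open>t = Z + 77\<close>: \<open>3t - 3, 3t + 3, 3t + 5, 4t - 4, 5t - 1\<close>, and \<open>m = 3t\<close>\<close>
  let ?m = "3 * Z + 231"
  let ?ns = "[3 * Z + 228, 3 * Z + 234, 3 * Z + 236, 4 * Z + 304, 5 * Z + 384, 12, 14, 23]"
  show "(\<Sum>n\<leftarrow>?ns. \<Sum>k=1..n. signed_square ?m k) = (real Z)\<^sup>2"
    \<comment> \<open>The first and the last three segments end below \<open>?m\<close>; the other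
      four pass it and so contain inward steps.\<close>
    using pyramidal_identity[of "real Z"] unfolding sum_signed_square by simp
qed (use assms in simp_all)

end
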